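(* Let $k\ge1$ be an integer and let $\{\mathbf{u}^n\}_{n\in\mathbb{N}}$ be the sequence generated, with step size $s>0$, by the BDF-$k$ accelerated gradient algorithm described in the context. Then for every $n\ge k$, $$\mathcal{M}(\widetilde{\mathbf{u}}^n,\widetilde{\mathbf{u}}^n)+\|\dot{\mathbf{u}}^n\|_U^2\le\mathcal{M}(\widetilde{\mathbf{u}}^{n-1},\widetilde{\mathbf{u}}^{n-1})+\|\dot{\mathbf{u}}^{n-1}\|_U^2,$$ where $\widetilde{\mathbf{u}}^n,\widetilde{\mathbf{u}}^{n-1},\dot{\mathbf{u}}^n,\dot{\mathbf{u}}^{n-1}$ are given by the BDF-$k$ formulas.
   Context: Setting. $\Omega\subset\mathbb{R}^d$ is a bounded Lipschitz domain; $U$ is a real Hilbert space of functions $\Omega\to\mathbb{R}^m$ continuously embedded in $H^1(\Omega;\mathbb{R}^m)$; $U_D\subset U$ is the set of functions satisfying given Dirichlet conditions on $\Gamma_D\subset\partial\Omega$ and $U_0\subset U$ is the closed linear subspace of functions satisfying the corresponding homogeneous conditions. $Z$ is a normed function space on $\Omega$, $B:U\times U\to Z$ is symmetric bilinear with $\|B(\mathbf{v},\mathbf{v})\|_Z\le c_Z\|\mathbf{v}\|_U^2$, and $\mathbf{u}_c\in Z$. $\mathcal{M}:U\times U\to\mathbb{R}$ is symmetric bilinear with $\mathcal{M}(\mathbf{v},\mathbf{v})\ge C_1\|\mathbf{v}\|_U^2$ and $\mathcal{M}(\mathbf{v},\mathbf{w})\le C_2\|\mathbf{v}\|_U\|\mathbf{w}\|_U$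 on $U$ ($C_1,C_2>0$). $\mathcal{A}=\{\mathbf{u}\in U_D:B(\mathbf{u},\mathbf{u})=\mathbf{u}_c\}$ and $\mathcal{F}_{\mathbf{u}}=\{\mathbf{v}\in U_0:B(\mathbf{u},\mathbf{v})=0\}$. BDF-$k$ formulas. $\delta_0=\sum_{r=1}^k\frac1r$, $\delta_i=\frac{(-1)^i}{i}\binom{k}{i}$ ($1\le i\le k$), $\gamma_j=(-1)^j\binom{k}{j+1}$ and $\tilde\delta_j=\sum_{\ell=0}^j\delta_\ell$ ($0\le j\le k-1$); $$\dot{\mathbf{u}}^n=\frac1s\sum_{j=0}^k\delta_j\mathbf{u}^{n-j},\quad\hat{\mathbf{u}}^n=\sum_{j=0}^{k-1}\gamma_j\mathbf{u}^{n-j-1},\quad\widetilde{\mathbf{u}}^n=\sum_{j=0}^{k-1}\tilde\delta_j\mathbf{u}^{n-j},$$ with the convention $\mathbf{u}^{-1}:=\mathbf{u}^0$ (zero initial velocity). Algorithm (infinite sequence, no stopping). Fix $\alpha\ge3$, $s>0$, $t_n=ns$, $\mathbf{u}^0\in\mathcal{A}$. The BDF-$k$ step at index $n$ determines $\mathbf{u}^n$ from $\mathbf{u}^{n-1},\dots,\mathbf{u}^{n-k-1}$ by requiring $\dot{\mathbf{u}}^n\in\mathcal{F}_{\hat{\mathbf{u}}^n}$ and $$\Big(\tfrac{\dot{\mathbf{u}}^n-\dot{\mathbf{u}}^{n-1}}{s},\mathbf{w}\Big)_U+\tfrac{\alpha}{t_n}(\dot{\mathbf{u}}^n,\mathbf{w})_U+\mathcal{M}(\widetilde{\mathbf{u}}^n,\mathbf{w})=0\quad\text{for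 all }\mathbf{w}\in\mathcal{F}_{\hat{\mathbf{u}}^n},$$ all quantities being given by the BDF-$k$ formulas. The initial values $\mathbf{u}^1,\dots,\mathbf{u}^{k-1}$ are computed successively by the BDF-$p$ step at index $n=p$ (same equations with $k$ replaced by $p$), $p=1,\dots,k-1$; for $n\ge k$ the BDF-$k$ step is used. *)

theory Defs
  imports "HOL-Analysis.Analysis"
begin

text \<open>After a rigid motion, the domain is locally the region above the graph of a Lipschitz
  function of the remaining coordinates. The unit vector e plays the role of the vertical axis, and
  the argument of g is the orthogonal projection of x to the hyperplane perpendicular to e.\<close>

definition lipschitz_domain :: "(real^'d) set \<Rightarrow> bool" where
  "lipschitz_domain \<Omega> \<longleftrightarrow> open \<Omega> \<and> connected \<Omega> \<and> \<Omega> \<noteq> {} \<and>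
     (\<forall>p \<in> frontier \<Omega>. \<exists>r>0. \<exists>e g L. norm e = 1 \<and> L-lipschitz_on {y. y \<bullet> e = 0} g \<and>
        \<Omega> \<inter> ball p r = {x \<in> ball p r. x \<bullet> e > g (x - (x \<bullet> e) *\<^sub>R e)})"

definition partial_deriv :: "'d \<Rightarrow> (real^'d \<Rightarrow> real) \<Rightarrow> real^'d \<Rightarrow> real" where
  "partial_deriv j \<phi> x = frechet_derivative \<phi> (at x) (axis j 1)"

text \<open>If all iterated partial derivatives are differentiable, they are in particular continuous.\<close>

definition smooth_function :: "(real^'d \<Rightarrow> real) \<Rightarrow> bool" where
  "smooth_function \<phi> \<longleftrightarrow> (\<forall>js x. foldr partial_deriv js \<phi> differentiable (at x))"

definition test_functions :: "(real^'d) set \<Rightarrow> (real^'d \<Rightarrow> real) set" where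
  "test_functions \<Omega> = {\<phi>. smooth_function \<phi> \<and> (\<exists>K. compact K \<and> K \<subseteq> \<Omega> \<and> (\<forall>x. x \<notin> K \<longrightarrow> \<phi> x = 0))}"

definition square_integrable_on ::
    "(real^'d) set \<Rightarrow> (real^'d \<Rightarrow> 'e::euclidean_space) \<Rightarrow> bool" where
  "square_integrable_on \<Omega> f \<longleftrightarrow> f \<in> borel_measurable (lebesgue_on \<Omega>) \<and>
     integrable (lebesgue_on \<Omega>) (\<lambda>x. (norm (f x))\<^sup>2)"

text \<open>The entry (i, j) of the matrix-valued function G is the weak derivative of the i-th component
  of f in direction j.\<close>

definition is_weak_gradient ::
    "(real^'d) set \<Rightarrow> (real^'d \<Rightarrow> real^'m) \<Rightarrow> (real^'d \<Rightarrow> real^'d^'m) \<Rightarrow> bool" where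
  "is_weak_gradient \<Omega> f G \<longleftrightarrow> square_integrable_on \<Omega> G \<and>
     (\<forall>\<phi> \<in> test_functions \<Omega>. \<forall>i j.
        (\<integral>x. f x $ i * partial_deriv j \<phi> x \<partial>lebesgue_on \<Omega>) =
        - (\<integral>x. G x $ i $ j * \<phi> x \<partial>lebesgue_on \<Omega>))"

text \<open>Elements of H1 are functions; membership and norm are invariant under changes on null sets.\<close>

definition H1 :: "(real^'d) set \<Rightarrow> (real^'d \<Rightarrow> real^'m) set" where
  "H1 \<Omega> = {f. square_integrable_on \<Omega> f \<and> (\<exists>G. is_weak_gradient \<Omega> f G)}"

definition weak_gradient ::
    "(real^'d) set \<Rightarrow> (real^'d \<Rightarrow> real^'m) \<Rightarrow> real^'d \<Rightarrow> real^'d^'m" where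
  "weak_gradient \<Omega> f = (SOME G. is_weak_gradient \<Omega> f G)"

definition H1_norm :: "(real^'d) set \<Rightarrow> (real^'d \<Rightarrow> real^'m) \<Rightarrow> real" where
  "H1_norm \<Omega> f = sqrt ((\<integral>x. (norm (f x))\<^sup>2 \<partial>lebesgue_on \<Omega>)
                      + (\<integral>x. (norm (weak_gradient \<Omega> f x))\<^sup>2 \<partial>lebesgue_on \<Omega>))"

text \<open>A vector space of functions on a domain is given by a vector space type together with a map
  that sends each element to a representative. Functions agreeing almost everywhere on the domain
  are identified, so the map is linear and injective up to null sets.\<close>

definition function_space_on ::
    "(real^'d) set \<Rightarrow> ('u::real_vector \<Rightarrow> real^'d \<Rightarrow> 'e::real_vector) \<Rightarrow> bool" where
  "function_space_on \<Omega> rep \<longleftrightarrow>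
     (\<forall>v w. AE x in lebesgue_on \<Omega>. rep (v + w) x = rep v x + rep w x) \<and>
     (\<forall>c v. AE x in lebesgue_on \<Omega>. rep (c *\<^sub>R v) x = c *\<^sub>R rep v x) \<and>
     (\<forall>v. (AE x in lebesgue_on \<Omega>. rep v x = 0) \<longrightarrow> v = 0)"

definition continuously_embedded_in_H1 ::
    "(real^'d) set \<Rightarrow> ('u::real_normed_vector \<Rightarrow> real^'d \<Rightarrow> real^'m) \<Rightarrow> bool" where
  "continuously_embedded_in_H1 \<Omega> rep \<longleftrightarrow> function_space_on \<Omega> rep \<and>
     (\<forall>v. rep v \<in> H1 \<Omega>) \<and> (\<exists>C. \<forall>v. H1_norm \<Omega> (rep v) \<le> C * norm v)"

text \<open>Dirichlet conditions on a part \<open>\<Gamma>\<close> of the boundary have the form \<open>T v = g\<close>, where T is a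
  continuous linear boundary operator that depends only on the behaviour of v near \<open>\<Gamma>\<close>. Besides
  the trace, this covers traces of selected components or, when U has the required regularity, of
  derivatives (clamped conditions).\<close>

definition boundary_operator ::
    "(real^'d) set \<Rightarrow> (real^'d) set \<Rightarrow> ('u::real_normed_vector \<Rightarrow> real^'d \<Rightarrow> real^'m) \<Rightarrow>
     ('u \<Rightarrow> 'b::real_normed_vector) \<Rightarrow> bool" where
  "boundary_operator \<Omega> \<Gamma> rep T \<longleftrightarrow> bounded_linear T \<and>
     (\<forall>v V. open V \<and> \<Gamma> \<subseteq> V \<and> (AE x in lebesgue_on (\<Omega> \<inter> V). rep v x = 0) \<longrightarrow> T v = 0)"

definition dirichlet_set :: "('u \<Rightarrow> 'b) \<Rightarrow> 'b \<Rightarrow> 'u set" where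
  "dirichlet_set T g = {v. T v = g}"

definition admissible_set :: "('u \<Rightarrow> 'u \<Rightarrow> 'z) \<Rightarrow> 'z \<Rightarrow> 'u set \<Rightarrow> 'u set" where
  "admissible_set B uc UD = {u \<in> UD. B u u = uc}"

definition tangent_space :: "('u \<Rightarrow> 'u \<Rightarrow> 'z::zero) \<Rightarrow> 'u set \<Rightarrow> 'u \<Rightarrow> 'u set" where
  "tangent_space B U0 u = {v \<in> U0. B u v = 0}"

definition bdf_delta :: "nat \<Rightarrow> nat \<Rightarrow> real" where
  "bdf_delta k i = (if i = 0 then (\<Sum>r=1..k. 1 / real r)
                    else (- 1) ^ i / real i * real (k choose i))"

definition bdf_gamma :: "nat \<Rightarrow> nat \<Rightarrow> real" where
  "bdf_gamma k j = (- 1) ^ j * real (k choose (j + 1))"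

definition bdf_delta_tilde :: "nat \<Rightarrow> nat \<Rightarrow> real" where
  "bdf_delta_tilde k j = (\<Sum>l=0..j. bdf_delta k l)"

definition bdf_dot :: "nat \<Rightarrow> real \<Rightarrow> (int \<Rightarrow> 'u::real_vector) \<Rightarrow> int \<Rightarrow> 'u" where
  "bdf_dot k s u n = (1 / s) *\<^sub>R (\<Sum>j=0..k. bdf_delta k j *\<^sub>R u (n - int j))"

definition bdf_hat :: "nat \<Rightarrow> (int \<Rightarrow> 'u::real_vector) \<Rightarrow> int \<Rightarrow> 'u" where
  "bdf_hat k u n = (\<Sum>j<k. bdf_gamma k j *\<^sub>R u (n - int j - 1))"

definition bdf_tilde :: "nat \<Rightarrow> (int \<Rightarrow> 'u::real_vector) \<Rightarrow> int \<Rightarrow> 'u" where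
  "bdf_tilde k u n = (\<Sum>j<k. bdf_delta_tilde k j *\<^sub>R u (n - int j))"

text \<open>Zero initial velocity. Among the negative indices only -1 is ever used.\<close>

definition extend_initial :: "(nat \<Rightarrow> 'u) \<Rightarrow> int \<Rightarrow> 'u" where
  "extend_initial u i = (if i < 0 then u 0 else u (nat i))"

definition bdf_step ::
    "nat \<Rightarrow> real \<Rightarrow> real \<Rightarrow> ('u::real_inner \<Rightarrow> 'u \<Rightarrow> 'z::zero) \<Rightarrow> ('u \<Rightarrow> 'u \<Rightarrow> real) \<Rightarrow> 'u set \<Rightarrow>
     (int \<Rightarrow> 'u) \<Rightarrow> int \<Rightarrow> bool" where
  "bdf_step k s \<alpha> B M U0 u n \<longleftrightarrow>
     bdf_dot k s u n \<in> tangent_space B U0 (bdf_hat k u n) \<and>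
     (\<forall>w \<in> tangent_space B U0 (bdf_hat k u n).
        ((1 / s) *\<^sub>R (bdf_dot k s u n - bdf_dot k s u (n - 1))) \<bullet> w
        + \<alpha> / (of_int n * s) * (bdf_dot k s u n \<bullet> w)
        + M (bdf_tilde k u n) w = 0)"

definition bdf_algorithm ::
    "nat \<Rightarrow> real \<Rightarrow> real \<Rightarrow> ('u::real_inner \<Rightarrow> 'u \<Rightarrow> 'z::zero) \<Rightarrow> 'z \<Rightarrow> ('u \<Rightarrow> 'u \<Rightarrow> real) \<Rightarrow>
     'u set \<Rightarrow> 'u set \<Rightarrow> (nat \<Rightarrow> 'u) \<Rightarrow> bool" where
  "bdf_algorithm k s \<alpha> B uc M UD U0 u \<longleftrightarrow>
     u 0 \<in> admissible_set B uc UD \<and>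
     (\<forall>p \<in> {1..<k}. bdf_step p s \<alpha> B M U0 (extend_initial u) (int p)) \<and>
     (\<forall>n \<ge> k. bdf_step k s \<alpha> B M U0 (extend_initial u) (int n))"

end

theory Submission
  imports Defs
begin

text \<open>Since the coefficients \<open>\<delta>\<^sub>j\<close> add up to zero, their partial sums satisfy the telescoping relation
  \<open>bdf_tilde(n) - bdf_tilde(n - 1) = s bdf_dot(n)\<close>.
  Testing the scheme with \<open>w = bdf_dot(n)\<close> therefore turns both the inertial term and the term in M into
  differences of the form \<open>b(x, x - y)\<close> with b symmetric and positive, and these are bounded below
  by \<open>(b(x, x) - b(y, y)) / 2\<close>.\<close>

text \<open>Induction on \<open>k\<close>: Pascal's rule splits off the sum for \<open>k\<close>,
  and absorbing the factor 1/i into the remaining binomials leaves 1/(k+1) times an alternating row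
  sum without its first term, that is -1/(k+1).\<close>

lemma alternating_binomial_over_index_sum:
  "(\<Sum>i=1..k. (- 1) ^ i / real i * real (k choose i)) = - (\<Sum>r=1..k. 1 / real r)"
proof (induction k)
  case 0
  show ?case by simp
next
  case (Suc k)
  have absorb: "(- 1) ^ i / real i * real (k choose (i - 1))
      = (- 1) ^ i * real (Suc k choose i) / real (Suc k)" if i: "i \<in> {1..Suc k}" for i
  proof -
    from i obtain j where j: "i = Suc j" by (cases i) auto
    have "real (Suc j) * real (Suc k choose Suc j) = real (Suc k) * real (k choose j)"
      by (metis Suc_times_binomial of_nat_mult)
    then show ?thesis
      unfolding j by (simp add: field_simps del: binomial_Suc_Suc of_nat_Suc)
  qed
  have pascal: "(- 1) ^ i / real i * real (Suc k choose i)
      = (- 1) ^ i / real i * real (k choose i) + (- 1) ^ i / real i * real (k choose (i - 1))"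
    if i: "i \<in> {1..Suc k}" for i
  proof -
    from i obtain j where "i = Suc j" by (cases i) auto
    then show ?thesis by (simp add: algebra_simps add_divide_distrib)
  qed
  \<comment> \<open>Expansion of (1 - 1)^(k+1), which vanishes since the exponent is
    positive.\<close>
  have "(\<Sum>i\<le>Suc k. (- 1) ^ i * real (Suc k choose i)) = 0"
    using choose_alternating_sum[of "Suc k", where ?'a = real] by simp
  moreover have "(\<Sum>i\<le>Suc k. (- 1) ^ i * real (Suc k choose i))
      = 1 + (\<Sum>i=1..Suc k. (- 1) ^ i * real (Suc k choose i))"
    by (simp add: atMost_atLeast0 sum.atLeast_Suc_atMost del: sum.cl_ivl_Suc binomial_Suc_Suc)
  ultimately have alt: "(\<Sum>i=1..Suc k. (- 1) ^ i * real (Suc k choose i)) = - 1"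
    by linarith
  have "(\<Sum>i=1..Suc k. (- 1) ^ i / real i * real (Suc k choose i))
      = (\<Sum>i=1..Suc k. (- 1) ^ i / real i * real (k choose i))
        + (\<Sum>i=1..Suc k. (- 1) ^ i / real i * real (k choose (i - 1)))"
    by (subst sum.distrib[symmetric], rule sum.cong[OF refl pascal])
  also have "(\<Sum>i=1..Suc k. (- 1) ^ i / real i * real (k choose (i - 1)))
      = (\<Sum>i=1..Suc k. (- 1) ^ i * real (Suc k choose i) / real (Suc k))"
    by (rule sum.cong[OF refl absorb])
  also have "\<dots> = - 1 / real (Suc k)"
    by (simp only: sum_divide_distrib[symmetric] alt)
  \<comment> \<open>The extra top term vanishes because \<open>k choose Suc k\<close> is 0.\<close>
  also have "(\<Sum>i=1..Suc k. (- 1) ^ i / real i * real (k choose i))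
      = - (\<Sum>r=1..k. 1 / real r)"
    using Suc.IH by simp
  finally show ?case by simp
qed

text \<open>Consistency of the difference formula: it annihilates constants, because the harmonic
  number \<delta>_0 cancels the other coefficients.\<close>

lemma sum_bdf_delta: "(\<Sum>l=0..k. bdf_delta k l) = 0"
proof -
  have "(\<Sum>l=0..k. bdf_delta k l) = bdf_delta k 0 + (\<Sum>l=1..k. bdf_delta k l)"
    by (simp add: sum.atLeast_Suc_atMost)
  also have "(\<Sum>l=1..k. bdf_delta k l) = (\<Sum>i=1..k. (- 1) ^ i / real i * real (k choose i))"
    by (rule sum.cong) (auto simp: bdf_delta_def)
  finally show ?thesis
    unfolding alternating_binomial_over_index_sum by (simp add: bdf_delta_def)
qed

text \<open>Abel summation. The boundary term carries the total sum of the coefficients, hence drops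
  out for \<open>bdf_delta\<close>.\<close>

lemma sum_by_parts_partial_sums:
  fixes c :: "nat \<Rightarrow> real" and v :: "nat \<Rightarrow> 'a::real_vector"
  shows "(\<Sum>j=0..k. c j *\<^sub>R v j)
    = (\<Sum>j<k. (\<Sum>l=0..j. c l) *\<^sub>R v j) - (\<Sum>j<k. (\<Sum>l=0..j. c l) *\<^sub>R v (Suc j))
      + (\<Sum>l=0..k. c l) *\<^sub>R v k"
  by (induction k) (simp_all add: algebra_simps)

lemma bdf_tilde_diff:
  assumes "s \<noteq> 0"
  shows "bdf_tilde k u n - bdf_tilde k u (n - 1) = s *\<^sub>R bdf_dot k s u n"
proof -
  \<comment> \<open>Turns the values entering \<open>bdf_tilde k u (n - 1)\<close> into the shifted
    values \<open>v (Suc j)\<close> of the summation by parts.\<close>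
  have shift: "n - 1 - int j = n - int (Suc j)" for j
    by simp
  show ?thesis
    using sum_by_parts_partial_sums[of "bdf_delta k" "\<lambda>j. u (n - int j)" k] assms
    unfolding bdf_tilde_def bdf_dot_def bdf_delta_tilde_def shift sum_bdf_delta by simp
qed

text \<open>Expand b(x - y, x - y) \<ge> 0. Used below for both the inner product and
  \<open>M\<close>.\<close>

lemma bilinear_diff_lower_bound:
  fixes b :: "'a::real_vector \<Rightarrow> 'a \<Rightarrow> real"
  assumes "bilinear b" and "\<And>v w. b v w = b w v" and "\<And>v. b v v \<ge> 0"
  shows "b x x - b y y \<le> 2 * b x (x - y)"
proof -
  have "0 \<le> b (x - y) (x - y)" by (rule assms)
  also have "\<dots> = b x x - 2 * b x y + b y y"
    using assms(2)[of y x] by (simp add: bilinear_lsub bilinear_rsub assms(1))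
  finally show ?thesis
    by (simp add: bilinear_rsub assms(1))
qed

lemma bdf_step_energy_decay:
  fixes M :: "'u::real_inner \<Rightarrow> 'u \<Rightarrow> real"
  assumes M: "bilinear M" "\<And>v w. M v w = M w v" "\<And>v. M v v \<ge> 0"
    and "s > 0" and "\<alpha> \<ge> 0" and "n \<ge> 0"
    and step: "bdf_step k s \<alpha> B M U0 u n"
  shows "M (bdf_tilde k u n) (bdf_tilde k u n) + (norm (bdf_dot k s u n))\<^sup>2
    \<le> M (bdf_tilde k u (n - 1)) (bdf_tilde k u (n - 1)) + (norm (bdf_dot k s u (n - 1)))\<^sup>2"
proof -
  define d d' x y where "d = bdf_dot k s u n" and "d' = bdf_dot k s u (n - 1)"
    and "x = bdf_tilde k u n" and "y = bdf_tilde k u (n - 1)"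
  \<comment> \<open>The first clause of \<open>bdf_step\<close> places \<open>d\<close> in the
    tangent space, so it may serve as the test vector.\<close>
  have "((1 / s) *\<^sub>R (d - d')) \<bullet> d + \<alpha> / (of_int n * s) * (d \<bullet> d) + M x d = 0"
    using step unfolding bdf_step_def d_def d'_def x_def by blast
  \<comment> \<open>Scaling by \<open>s\<close> cancels 1/s in the inertial term and turns
    \<open>d\<close> into \<open>x - y\<close> inside \<open>M\<close>.\<close>
  then have "s * ((1 / s) * (d \<bullet> (d - d')) + \<alpha> / (of_int n * s) * (d \<bullet> d) + M x d) = 0"
    by (simp add: inner_commute)
  moreover have "M x (x - y) = s * M x d"
    using bdf_tilde_diff[of s k u n] \<open>s > 0\<close>
    by (simp add: x_def y_def d_def bilinear_rmul[OF M(1)])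
  \<comment> \<open>The damping term only dissipates; at \<open>n = 0\<close> it is 0, as division
    by zero yields 0.\<close>
  moreover have "0 \<le> s * (\<alpha> / (of_int n * s) * (d \<bullet> d))"
    using \<open>s > 0\<close> \<open>\<alpha> \<ge> 0\<close> \<open>n \<ge> 0\<close> by simp
  ultimately have "d \<bullet> (d - d') + M x (x - y) \<le> 0"
    using \<open>s > 0\<close> by (simp add: distrib_left)
  moreover have "d \<bullet> d - d' \<bullet> d' \<le> 2 * (d \<bullet> (d - d'))"
    by (rule bilinear_diff_lower_bound)
      (simp_all add: bilinear_def linear_iff inner_add inner_commute)
  moreover have "M x x - M y y \<le> 2 * M x (x - y)"
    by (rule bilinear_diff_lower_bound[OF M])
  ultimately show ?thesis
    unfolding power2_norm_eq_inner d_def[symmetric] d'_def[symmetric] x_def[symmetric]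
      y_def[symmetric] by linarith
qed

theorem theorem5p1:
  fixes \<Omega> \<Gamma>D :: "(real^'d) set"
    and repU :: "'u::{real_inner, complete_space} \<Rightarrow> real^'d \<Rightarrow> real^'m"
    and repZ :: "'z::real_normed_vector \<Rightarrow> real^'d \<Rightarrow> 'e::real_normed_vector"
    and T :: "'u \<Rightarrow> 'b::real_normed_vector" and g :: 'b
    and UD U0 :: "'u set"
    and B :: "'u \<Rightarrow> 'u \<Rightarrow> 'z" and cZ :: real and uc :: 'z
    and M :: "'u \<Rightarrow> 'u \<Rightarrow> real" and C1 C2 :: real
    and k :: nat and s \<alpha> :: real and u :: "nat \<Rightarrow> 'u"
  assumes "bounded \<Omega>" and "lipschitz_domain \<Omega>"
    and "continuously_embedded_in_H1 \<Omega> repU"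
    and "\<Gamma>D \<subseteq> frontier \<Omega>" and "boundary_operator \<Omega> \<Gamma>D repU T"
    and "UD = dirichlet_set T g" and "U0 = dirichlet_set T 0"
    and "function_space_on \<Omega> repZ"
    and "bilinear B" and "\<And>v w. B v w = B w v"
    and "\<And>v. norm (B v v) \<le> cZ * (norm v)\<^sup>2"
    and "bilinear M" and "\<And>v w. M v w = M w v"
    and "C1 > 0" and "\<And>v. M v v \<ge> C1 * (norm v)\<^sup>2"
    and "C2 > 0" and "\<And>v w. M v w \<le> C2 * norm v * norm w"
    and "k \<ge> 1" and "s > 0" and "\<alpha> \<ge> 3"
    and "bdf_algorithm k s \<alpha> B uc M UD U0 u"
  shows "\<forall>n \<ge> k.
      M (bdf_tilde k (extend_initial u) (int n)) (bdf_tilde k (extend_initial u) (int n))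
        + (norm (bdf_dot k s (extend_initial u) (int n)))\<^sup>2
      \<le> M (bdf_tilde k (extend_initial u) (int n - 1)) (bdf_tilde k (extend_initial u) (int n - 1))
        + (norm (bdf_dot k s (extend_initial u) (int n - 1)))\<^sup>2"
proof (intro allI impI)
  fix n assume "n \<ge> k"
  \<comment> \<open>For \<open>n = k\<close>, \<open>bdf_dot\<close> at \<open>n - 1\<close> reaches
    index -1, where \<open>extend_initial\<close> supplies \<open>u 0\<close>.\<close>
  then have step: "bdf_step k s \<alpha> B M U0 (extend_initial u) (int n)"
    using \<open>bdf_algorithm k s \<alpha> B uc M UD U0 u\<close> by (simp add: bdf_algorithm_def)
  have "M v v \<ge> 0" for v
    using \<open>C1 * (norm v)\<^sup>2 \<le> M v v\<close> \<open>C1 > 0\<close>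
    by (meson less_imp_le mult_nonneg_nonneg order_trans zero_le_power2)
  then show "M (bdf_tilde k (extend_initial u) (int n)) (bdf_tilde k (extend_initial u) (int n))
        + (norm (bdf_dot k s (extend_initial u) (int n)))\<^sup>2
      \<le> M (bdf_tilde k (extend_initial u) (int n - 1)) (bdf_tilde k (extend_initial u) (int n - 1))
        + (norm (bdf_dot k s (extend_initial u) (int n - 1)))\<^sup>2"
    using \<open>s > 0\<close> \<open>\<alpha> \<ge> 3\<close>
    by (intro bdf_step_energy_decay[OF \<open>bilinear M\<close> \<open>\<And>v w. M v w = M w v\<close> _ _ _ _ step]) auto
qed

end
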